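(* Let $p$ be a prime and $n\geq 2$ an integer, and consider the $\mathbb{Z}$-module $M=\mathbb{Q}\oplus\mathbb{Z}_{p^n}$. Then $\mathbb{Q}$ and $\mathbb{Z}_{p^n}$ are CS-modules, $\mathbb{Q}$ is $\mathbb{Z}_{p^n}$-injective, and $Z_2(M)$ is a CS-module, but $M$ is not a CS-module. Consequently, the following assertion is false: if $M=M_1\oplus M_2$, where $M_1$ and $M_2$ are CS-modules such that $M_1$ is $M_2$-injective, then $M$ is a CS-module if and only if $Z_2(M)$ is a CS-module.
   Context: Modules are unital right modules over an associative ring $R$ with identity (here $R=\mathbb{Z}$), and $\mathbb{Z}_{p^n}=\mathbb{Z}/p^n\mathbb{Z}$. $S\leq M$ is essential in $M$ ($S\leq_e M$) if for any $T\leq M$, $S\cap T=0$ implies $T=0$. $M$ is a CS-module if for any submodule $N$ of $M$ there exists a direct summand $K$ of $M$ with $N\leq_e K$. The singular submodule is $Z(M)=\{m\in M : mI=0 \text{ for some essential right ideal } I \text{ of } R\}$; the second singular submodule $Z_2(M)$ is the submodule containing $Z(M)$ with $Z_2(M)/Z(M)=Z(M/Z(M))$. A module $N$ is $A$-injective if every homomorphism from a submodule of $A$ to $N$ extends to a homomorphism $A\to N$. *)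

theory Defs
  imports Complex_Main "HOL-Algebra.IntRing" "HOL-Algebra.Module"
begin

text \<open>
  The modules considered here are those of the locale \<^locale>\<open>Module.module\<close>, whose ring of
  scalars is commutative, so that right and left modules coincide; \<open>r \<odot> m\<close> stands for
  \<open>m r\<close>. A submodule \<open>N\<close> of \<open>M\<close> is regarded as a module in its own right through
  \<open>M\<lparr>carrier := N\<rparr>\<close>. The fields \<^const>\<open>mult\<close> and \<^const>\<open>one\<close> of a module
  record carry no meaning.
\<close>

definition essential :: "('a, 'c) ring_scheme \<Rightarrow> ('a, 'b, 'd) module_scheme \<Rightarrow> 'b set \<Rightarrow> bool"
  where "essential R M S \<longleftrightarrow> submodule S R M \<and>
    (\<forall>T. submodule T R M \<longrightarrow> S \<inter> T = {\<zero>\<^bsub>M\<^esub>} \<longrightarrow> T = {\<zero>\<^bsub>M\<^esub>})"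

definition internal_sum ::
    "('a, 'c) ring_scheme \<Rightarrow> ('a, 'b, 'd) module_scheme \<Rightarrow> 'b set \<Rightarrow> 'b set \<Rightarrow> bool"
  where "internal_sum R M K L \<longleftrightarrow> submodule K R M \<and> submodule L R M \<and>
    K <+>\<^bsub>M\<^esub> L = carrier M \<and> K \<inter> L = {\<zero>\<^bsub>M\<^esub>}"

definition direct_summand ::
    "('a, 'c) ring_scheme \<Rightarrow> ('a, 'b, 'd) module_scheme \<Rightarrow> 'b set \<Rightarrow> bool"
  where "direct_summand R M K \<longleftrightarrow> (\<exists>L. internal_sum R M K L)"

definition CS_module :: "('a, 'c) ring_scheme \<Rightarrow> ('a, 'b, 'd) module_scheme \<Rightarrow> bool"
  where "CS_module R M \<longleftrightarrow> module R M \<and>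
    (\<forall>N. submodule N R M \<longrightarrow>
      (\<exists>K. direct_summand R M K \<and> essential R (M\<lparr>carrier := K\<rparr>) N))"

definition mod_hom ::
    "('a, 'c) ring_scheme \<Rightarrow> ('a, 'b, 'd) module_scheme \<Rightarrow> ('a, 'e, 'f) module_scheme \<Rightarrow> ('b \<Rightarrow> 'e) set"
  where "mod_hom R M N = {f \<in> hom (add_monoid M) (add_monoid N).
    \<forall>r\<in>carrier R. \<forall>x\<in>carrier M. f (r \<odot>\<^bsub>M\<^esub> x) = r \<odot>\<^bsub>N\<^esub> f x}"

text \<open>\<open>rel_injective R N A\<close>: the module \<open>N\<close> is \<open>A\<close>-injective.\<close>

definition rel_injective ::
    "('a, 'c) ring_scheme \<Rightarrow> ('a, 'b, 'd) module_scheme \<Rightarrow> ('a, 'e, 'f) module_scheme \<Rightarrow> bool"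
  where "rel_injective R N A \<longleftrightarrow>
    (\<forall>B. submodule B R A \<longrightarrow>
      (\<forall>f \<in> mod_hom R (A\<lparr>carrier := B\<rparr>) N. \<exists>g \<in> mod_hom R A N. \<forall>x\<in>B. g x = f x))"

text \<open>The submodules of the right module \<open>R\<close> are exactly the right ideals of \<open>R\<close>.\<close>

definition regular_module :: "('a, 'c) ring_scheme \<Rightarrow> ('a, 'a) module"
  where "regular_module R = \<lparr>carrier = carrier R, mult = mult R, one = \<one>\<^bsub>R\<^esub>,
    zero = \<zero>\<^bsub>R\<^esub>, add = add R, smult = (\<lambda>r x. x \<otimes>\<^bsub>R\<^esub> r)\<rparr>"

definition quotient_module :: "('a, 'b, 'd) module_scheme \<Rightarrow> 'b set \<Rightarrow> ('a, 'b set) module"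
  where "quotient_module M N = \<lparr>carrier = a_rcosets\<^bsub>M\<^esub> N, mult = rcoset_mult M N,
    one = N +>\<^bsub>M\<^esub> \<one>\<^bsub>M\<^esub>, zero = N, add = set_add M,
    smult = (\<lambda>r X. \<Union>x\<in>X. N +>\<^bsub>M\<^esub> (r \<odot>\<^bsub>M\<^esub> x))\<rparr>"

definition module_sum ::
    "('a, 'b, 'd) module_scheme \<Rightarrow> ('a, 'e, 'f) module_scheme \<Rightarrow> ('a, 'b \<times> 'e) module"
  where "module_sum M N = \<lparr>carrier = carrier M \<times> carrier N,
    mult = (\<lambda>(x, y) (x', y'). (x \<otimes>\<^bsub>M\<^esub> x', y \<otimes>\<^bsub>N\<^esub> y')),
    one = (\<one>\<^bsub>M\<^esub>, \<one>\<^bsub>N\<^esub>),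
    zero = (\<zero>\<^bsub>M\<^esub>, \<zero>\<^bsub>N\<^esub>),
    add = (\<lambda>(x, y) (x', y'). (x \<oplus>\<^bsub>M\<^esub> x', y \<oplus>\<^bsub>N\<^esub> y')),
    smult = (\<lambda>r (x, y). (r \<odot>\<^bsub>M\<^esub> x, r \<odot>\<^bsub>N\<^esub> y))\<rparr>"

definition singular :: "('a, 'c) ring_scheme \<Rightarrow> ('a, 'b, 'd) module_scheme \<Rightarrow> 'b set"
  where "singular R M = {m \<in> carrier M.
    \<exists>I. essential R (regular_module R) I \<and> (\<forall>r\<in>I. r \<odot>\<^bsub>M\<^esub> m = \<zero>\<^bsub>M\<^esub>)}"

text \<open>
  The second singular submodule is the preimage of \<open>Z(M/Z(M))\<close> in \<open>M\<close>. By the lemmas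
  \<open>second_singular\<close> and \<open>second_singular_unique\<close> below it is the one submodule
  \<open>N \<supseteq> Z(M)\<close> with \<open>N/Z(M) = Z(M/Z(M))\<close>.
\<close>

definition second_singular :: "('a, 'c) ring_scheme \<Rightarrow> ('a, 'b, 'd) module_scheme \<Rightarrow> 'b set"
  where "second_singular R M = {m \<in> carrier M.
    singular R M +>\<^bsub>M\<^esub> m \<in> singular R (quotient_module M (singular R M))}"

definition rat_module :: "(int, rat) module"
  where "rat_module = \<lparr>carrier = UNIV, mult = (*), one = 1, zero = 0, add = (+),
    smult = (\<lambda>k q. of_int k * q)\<rparr>"

definition Zmod_module :: "int \<Rightarrow> (int, int set) module"
  where "Zmod_module m = quotient_module (regular_module \<Z>) (PIdl\<^bsub>\<Z>\<^esub> m)"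

lemma (in module) submodule_abelian_subgroup:
  assumes "submodule N R M"
  shows "abelian_subgroup N M"
  using assms unfolding submodule_def
  by (intro abelian_subgroupI3 additive_subgroup.intro M.abelian_group_axioms) simp_all

lemma (in module) quotient_smult:
  assumes N: "submodule N R M" and r: "r \<in> carrier R" and x: "x \<in> carrier M"
  shows "r \<odot>\<^bsub>quotient_module M N\<^esub> (N +>\<^bsub>M\<^esub> x) = N +>\<^bsub>M\<^esub> (r \<odot>\<^bsub>M\<^esub> x)"
proof -
  interpret N: abelian_subgroup N M by (rule submodule_abelian_subgroup[OF N])
  have *: "N +>\<^bsub>M\<^esub> (r \<odot>\<^bsub>M\<^esub> y) = N +>\<^bsub>M\<^esub> (r \<odot>\<^bsub>M\<^esub> x)" if y: "y \<in> N +>\<^bsub>M\<^esub> x" for y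
  proof -
    obtain h where h: "h \<in> N" "y = h \<oplus>\<^bsub>M\<^esub> x" using y by (auto simp: a_r_coset_def')
    have hM: "h \<in> carrier M" using h(1) N.a_subset by blast
    have "r \<odot>\<^bsub>M\<^esub> y = r \<odot>\<^bsub>M\<^esub> h \<oplus>\<^bsub>M\<^esub> r \<odot>\<^bsub>M\<^esub> x" using h hM r x by (simp add: smult_r_distr)
    moreover have "r \<odot>\<^bsub>M\<^esub> h \<in> N" using submodule.smult_closed[OF N r h(1)] .
    ultimately have "r \<odot>\<^bsub>M\<^esub> y \<in> N +>\<^bsub>M\<^esub> (r \<odot>\<^bsub>M\<^esub> x)" by (auto simp: a_r_coset_def')
    then show ?thesis using N.a_repr_independence' r x by blast
  qed
  have "N +>\<^bsub>M\<^esub> x \<noteq> {}" using N.a_rcos_self[OF x] by blast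
  moreover have "(\<Union>y \<in> N +>\<^bsub>M\<^esub> x. N +>\<^bsub>M\<^esub> (r \<odot>\<^bsub>M\<^esub> y)) =
      (\<Union>y \<in> N +>\<^bsub>M\<^esub> x. N +>\<^bsub>M\<^esub> (r \<odot>\<^bsub>M\<^esub> x))"
    by (rule SUP_cong[OF refl *])
  ultimately show ?thesis by (simp add: quotient_module_def)
qed

lemma (in module) quotient_carrierE:
  assumes "X \<in> carrier (quotient_module M N)"
  obtains x where "x \<in> carrier M" "X = N +>\<^bsub>M\<^esub> x"
  using assms by (auto simp: quotient_module_def A_RCOSETS_def')

lemma carrier_quotient_submodule:
  "carrier (quotient_module (M\<lparr>carrier := N\<rparr>) Z) = (\<lambda>x. Z +>\<^bsub>M\<^esub> x) ` N"
  by (auto simp: quotient_module_def A_RCOSETS_def' a_r_coset_def')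

lemma (in module) quotient_module_is_module:
  assumes N: "submodule N R M"
  shows "module R (quotient_module M N)" (is "module R ?Q")
proof -
  interpret N: abelian_subgroup N M by (rule submodule_abelian_subgroup[OF N])
  have carr: "N +>\<^bsub>M\<^esub> x \<in> carrier ?Q" if "x \<in> carrier M" for x
    using that unfolding quotient_module_def A_RCOSETS_def' by simp blast
  have add: "(N +>\<^bsub>M\<^esub> x) \<oplus>\<^bsub>?Q\<^esub> (N +>\<^bsub>M\<^esub> y) = N +>\<^bsub>M\<^esub> (x \<oplus>\<^bsub>M\<^esub> y)"
    if "x \<in> carrier M" "y \<in> carrier M" for x y
    using that by (simp add: quotient_module_def N.a_rcos_sum)
  note sm = quotient_smult[OF N]
  have zero: "\<zero>\<^bsub>?Q\<^esub> = N +>\<^bsub>M\<^esub> \<zero>\<^bsub>M\<^esub>"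
    using N.a_rcos_const[OF N.zero_closed] by (simp add: quotient_module_def)
  have ag: "abelian_group ?Q"
  proof (rule abelian_groupI)
    show "\<zero>\<^bsub>?Q\<^esub> \<in> carrier ?Q" by (simp add: zero carr)
    fix X assume "X \<in> carrier ?Q"
    then obtain x where x: "x \<in> carrier M" "X = N +>\<^bsub>M\<^esub> x" by (rule quotient_carrierE)
    show "\<zero>\<^bsub>?Q\<^esub> \<oplus>\<^bsub>?Q\<^esub> X = X" using x by (simp add: zero add)
    show "\<exists>Y\<in>carrier ?Q. Y \<oplus>\<^bsub>?Q\<^esub> X = \<zero>\<^bsub>?Q\<^esub>"
      using x by (intro bexI[of _ "N +>\<^bsub>M\<^esub> (\<ominus>\<^bsub>M\<^esub> x)"]) (simp_all add: zero add carr M.l_neg)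
    fix Y assume "Y \<in> carrier ?Q"
    then obtain y where y: "y \<in> carrier M" "Y = N +>\<^bsub>M\<^esub> y" by (rule quotient_carrierE)
    show "X \<oplus>\<^bsub>?Q\<^esub> Y \<in> carrier ?Q" using x y by (simp add: add carr)
    show "X \<oplus>\<^bsub>?Q\<^esub> Y = Y \<oplus>\<^bsub>?Q\<^esub> X" using x y by (simp add: add M.a_comm)
    fix W assume "W \<in> carrier ?Q"
    then obtain w where w: "w \<in> carrier M" "W = N +>\<^bsub>M\<^esub> w" by (rule quotient_carrierE)
    show "X \<oplus>\<^bsub>?Q\<^esub> Y \<oplus>\<^bsub>?Q\<^esub> W = X \<oplus>\<^bsub>?Q\<^esub> (Y \<oplus>\<^bsub>?Q\<^esub> W)"
      using x y w by (simp add: add M.a_assoc)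
  qed
  show ?thesis
  proof (rule moduleI[OF R.is_cring ag])
    fix a b X Y
    assume a: "a \<in> carrier R" and X: "X \<in> carrier ?Q"
    obtain x where x: "x \<in> carrier M" "X = N +>\<^bsub>M\<^esub> x" using quotient_carrierE[OF X] .
    show "a \<odot>\<^bsub>?Q\<^esub> X \<in> carrier ?Q" using a x by (simp add: sm carr)
    show "a \<odot>\<^bsub>?Q\<^esub> (X \<oplus>\<^bsub>?Q\<^esub> Y) = a \<odot>\<^bsub>?Q\<^esub> X \<oplus>\<^bsub>?Q\<^esub> a \<odot>\<^bsub>?Q\<^esub> Y" if Y: "Y \<in> carrier ?Q"
    proof -
      obtain y where "y \<in> carrier M" "Y = N +>\<^bsub>M\<^esub> y" using quotient_carrierE[OF Y] .
      then show ?thesis using a x by (simp add: sm add smult_r_distr)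
    qed
    assume b: "b \<in> carrier R"
    show "(a \<oplus> b) \<odot>\<^bsub>?Q\<^esub> X = a \<odot>\<^bsub>?Q\<^esub> X \<oplus>\<^bsub>?Q\<^esub> b \<odot>\<^bsub>?Q\<^esub> X"
      using a b x by (simp add: sm add smult_l_distr)
    show "(a \<otimes> b) \<odot>\<^bsub>?Q\<^esub> X = a \<odot>\<^bsub>?Q\<^esub> (b \<odot>\<^bsub>?Q\<^esub> X)"
      using a b x by (simp add: sm smult_assoc1)
  next
    fix X assume X: "X \<in> carrier ?Q"
    obtain x where x: "x \<in> carrier M" "X = N +>\<^bsub>M\<^esub> x" using quotient_carrierE[OF X] .
    then show "\<one> \<odot>\<^bsub>?Q\<^esub> X = X" by (simp add: sm)
  qed
qed

lemma regular_module_is_module: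
  assumes "cring R"
  shows "module R (regular_module R)"
proof -
  interpret R: cring R by fact
  have "abelian_group (regular_module R)"
  proof (rule abelian_groupI)
    fix x assume "x \<in> carrier (regular_module R)"
    then show "\<exists>y\<in>carrier (regular_module R).
        y \<oplus>\<^bsub>regular_module R\<^esub> x = \<zero>\<^bsub>regular_module R\<^esub>"
      by (intro bexI[of _ "\<ominus>\<^bsub>R\<^esub> x"]) (simp_all add: regular_module_def R.l_neg)
  qed (simp_all add: regular_module_def R.a_ac)
  then show ?thesis
    by (intro moduleI assms) (simp_all add: regular_module_def R.l_distr R.r_distr R.m_ac)
qed

lemma (in module) submodule_Int:
  assumes H: "submodule H R M" and K: "submodule K R M"
  shows "submodule (H \<inter> K) R M"
proof (rule submoduleI)
  have z: "\<zero>\<^bsub>M\<^esub> \<in> N" if "submodule N R M" for N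
    by (rule additive_subgroup.zero_closed[OF
        abelian_subgroup.axioms(1)[OF submodule_abelian_subgroup[OF that]]])
  show "\<zero>\<^bsub>M\<^esub> \<in> H \<inter> K" using z H K by blast
  show "H \<inter> K \<subseteq> carrier M" using submoduleE(1)[OF H] by blast
qed (simp_all add: submoduleE(3-5)[OF H] submoduleE(3-5)[OF K])

lemma (in module) essential_Int:
  assumes "essential R M I" "essential R M J"
  shows "essential R M (I \<inter> J)"
  unfolding essential_def
proof (intro conjI allI impI)
  have I: "submodule I R M" and J: "submodule J R M" using assms by (auto simp: essential_def)
  show "submodule (I \<inter> J) R M" by (rule submodule_Int[OF I J])
  fix T assume T: "submodule T R M" and "I \<inter> J \<inter> T = {\<zero>\<^bsub>M\<^esub>}"
  then have "I \<inter> (J \<inter> T) = {\<zero>\<^bsub>M\<^esub>}" by blast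
  then have "J \<inter> T = {\<zero>\<^bsub>M\<^esub>}"
    using assms(1) submodule_Int[OF J T] by (auto simp: essential_def)
  then show "T = {\<zero>\<^bsub>M\<^esub>}" using assms(2) T by (auto simp: essential_def)
qed

lemma (in module) singular_submodule: "submodule (singular R M) R M"
proof (rule submoduleI)
  let ?E = "essential R (regular_module R)"
  interpret RR: module R "regular_module R" by (rule regular_module_is_module[OF R.is_cring])
  have sub: "I \<subseteq> carrier R" if "?E I" for I
    using that RR.submoduleE(1)[of I] by (auto simp: essential_def regular_module_def)
  show "singular R M \<subseteq> carrier M" by (auto simp: singular_def)
  have "?E (carrier R)"
  proof -
    have c: "carrier R = carrier (regular_module R)" by (simp add: regular_module_def)
    show ?thesis
      unfolding c essential_def using RR.carrier_is_submodule RR.submoduleE(1) by blast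
  qed
  then show "\<zero>\<^bsub>M\<^esub> \<in> singular R M" by (auto simp: singular_def)
  fix a assume "a \<in> singular R M"
  then obtain I where a: "a \<in> carrier M" and I: "?E I" "\<forall>r\<in>I. r \<odot>\<^bsub>M\<^esub> a = \<zero>\<^bsub>M\<^esub>"
    by (auto simp: singular_def)
  show "\<ominus>\<^bsub>M\<^esub> a \<in> singular R M"
    using a I sub[OF I(1)] by (auto simp: singular_def smult_r_minus subset_iff)
  show "a \<oplus>\<^bsub>M\<^esub> b \<in> singular R M" if bS: "b \<in> singular R M" for b
  proof -
    obtain J where b: "b \<in> carrier M" and J: "?E J" "\<forall>r\<in>J. r \<odot>\<^bsub>M\<^esub> b = \<zero>\<^bsub>M\<^esub>"
      using bS by (auto simp: singular_def)
    have "?E (I \<inter> J)" by (rule RR.essential_Int[OF I(1) J(1)])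
    moreover have "\<forall>r\<in>I \<inter> J. r \<odot>\<^bsub>M\<^esub> (a \<oplus>\<^bsub>M\<^esub> b) = \<zero>\<^bsub>M\<^esub>"
      using sub[OF I(1)] a b I(2) J(2) by (auto simp: smult_r_distr subset_iff)
    ultimately show ?thesis using a b by (auto simp: singular_def)
  qed
  show "r \<odot>\<^bsub>M\<^esub> a \<in> singular R M" if r: "r \<in> carrier R" for r
  proof -
    have "s \<odot>\<^bsub>M\<^esub> (r \<odot>\<^bsub>M\<^esub> a) = \<zero>\<^bsub>M\<^esub>" if s: "s \<in> I" for s
    proof -
      have sR: "s \<in> carrier R" using s sub[OF I(1)] by blast
      have "s \<odot>\<^bsub>M\<^esub> (r \<odot>\<^bsub>M\<^esub> a) = r \<odot>\<^bsub>M\<^esub> (s \<odot>\<^bsub>M\<^esub> a)"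
        using r sR a by (metis smult_assoc1 R.m_comm)
      then show ?thesis using I(2) s r by simp
    qed
    then show ?thesis using a r I(1) by (auto simp: singular_def)
  qed
qed

lemma (in module) second_singular:
  shows "submodule (second_singular R M) R M"
    and "singular R M \<subseteq> second_singular R M"
    and "carrier (quotient_module (M\<lparr>carrier := second_singular R M\<rparr>) (singular R M)) =
      singular R (quotient_module M (singular R M))"
proof -
  define Z where "Z = singular R M"
  define Q where "Q = quotient_module M Z"
  have Z: "submodule Z R M" unfolding Z_def by (rule singular_submodule)
  interpret Z: abelian_subgroup Z M by (rule submodule_abelian_subgroup[OF Z])
  interpret Q: module R Q unfolding Q_def by (rule quotient_module_is_module[OF Z])
  have SQ: "submodule (singular R Q) R Q" by (rule Q.singular_submodule)
  have zQ: "\<zero>\<^bsub>Q\<^esub> = Z" by (simp add: Q_def quotient_module_def)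
  have S: "second_singular R M = {m \<in> carrier M. Z +>\<^bsub>M\<^esub> m \<in> singular R Q}"
    by (simp add: second_singular_def Z_def Q_def)
  have add: "(Z +>\<^bsub>M\<^esub> x) \<oplus>\<^bsub>Q\<^esub> (Z +>\<^bsub>M\<^esub> y) = Z +>\<^bsub>M\<^esub> (x \<oplus>\<^bsub>M\<^esub> y)"
    if "x \<in> carrier M" "y \<in> carrier M" for x y
    using that by (simp add: Q_def quotient_module_def Z.a_rcos_sum)
  have sm: "r \<odot>\<^bsub>Q\<^esub> (Z +>\<^bsub>M\<^esub> x) = Z +>\<^bsub>M\<^esub> (r \<odot>\<^bsub>M\<^esub> x)"
    if "r \<in> carrier R" "x \<in> carrier M" for r x
    using quotient_smult[OF Z that] by (simp add: Q_def)
  have inZ: "Z +>\<^bsub>M\<^esub> x = Z" if "x \<in> Z" for x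
    using that by (metis Z.a_rcos_const)
  have Q0: "Z \<in> singular R Q"
    using SQ zQ by (metis submodule.axioms(1) subgroup.one_closed monoid.simps(2))
  have ss: "singular R Q \<subseteq> carrier Q" using Q.submoduleE(1)[OF SQ] .
  have sub: "Z \<subseteq> second_singular R M" unfolding S using inZ Q0 Z.a_subset by auto
  show "submodule (second_singular R M) R M"
  proof (rule submoduleI)
    show "second_singular R M \<subseteq> carrier M" by (auto simp: S)
    show "\<zero>\<^bsub>M\<^esub> \<in> second_singular R M" using sub Z.zero_closed by blast
    show smc: "r \<odot>\<^bsub>M\<^esub> x \<in> second_singular R M"
      if "r \<in> carrier R" "x \<in> second_singular R M" for r x
      using that Q.submoduleE(4)[OF SQ] by (auto simp: S sm[symmetric])
    show "x \<oplus>\<^bsub>M\<^esub> y \<in> second_singular R M"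
      if "x \<in> second_singular R M" "y \<in> second_singular R M" for x y
      using that Q.submoduleE(5)[OF SQ] by (auto simp: S add[symmetric])
    show "\<ominus>\<^bsub>M\<^esub> x \<in> second_singular R M" if x: "x \<in> second_singular R M" for x
    proof -
      have xM: "x \<in> carrier M" using x by (simp add: S)
      have "\<ominus>\<^bsub>M\<^esub> x = (\<ominus> \<one>) \<odot>\<^bsub>M\<^esub> x" using xM by (simp add: smult_l_minus)
      then show ?thesis using smc[of "\<ominus> \<one>" x] x by simp
    qed
  qed
  have "carrier (quotient_module (M\<lparr>carrier := second_singular R M\<rparr>) Z) =
      (\<lambda>x. Z +>\<^bsub>M\<^esub> x) ` second_singular R M"
    by (rule carrier_quotient_submodule)
  also have "\<dots> = singular R Q"
  proof
    show "(\<lambda>x. Z +>\<^bsub>M\<^esub> x) ` second_singular R M \<subseteq> singular R Q" by (auto simp: S)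
    show "singular R Q \<subseteq> (\<lambda>x. Z +>\<^bsub>M\<^esub> x) ` second_singular R M"
    proof
      fix X assume X: "X \<in> singular R Q"
      then have "X \<in> carrier (quotient_module M Z)" using ss Q_def by blast
      then obtain x where "x \<in> carrier M" "X = Z +>\<^bsub>M\<^esub> x" by (rule quotient_carrierE)
      then show "X \<in> (\<lambda>x. Z +>\<^bsub>M\<^esub> x) ` second_singular R M" using X by (auto simp: S)
    qed
  qed
  finally show "carrier (quotient_module (M\<lparr>carrier := second_singular R M\<rparr>) (singular R M)) =
      singular R (quotient_module M (singular R M))" by (simp add: Q_def Z_def)
  show "singular R M \<subseteq> second_singular R M" using sub by (simp add: Z_def)
qed

lemma (in module) second_singular_unique:
  assumes N: "submodule N R M" "singular R M \<subseteq> N"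
    and eq: "carrier (quotient_module (M\<lparr>carrier := N\<rparr>) (singular R M)) =
      singular R (quotient_module M (singular R M))"
  shows "N = second_singular R M"
proof -
  define Z where "Z = singular R M"
  interpret Z: abelian_subgroup Z M
    unfolding Z_def by (rule submodule_abelian_subgroup[OF singular_submodule])
  have im: "(\<lambda>x. Z +>\<^bsub>M\<^esub> x) ` N = singular R (quotient_module M Z)"
    using eq by (simp add: Z_def carrier_quotient_submodule)
  have NM: "N \<subseteq> carrier M" using submoduleE(1)[OF N(1)] .
  show ?thesis
  proof
    show "N \<subseteq> second_singular R M"
      using im NM by (auto simp: second_singular_def Z_def)
    show "second_singular R M \<subseteq> N"
    proof
      fix m assume "m \<in> second_singular R M"
      then have m: "m \<in> carrier M" "Z +>\<^bsub>M\<^esub> m \<in> singular R (quotient_module M Z)"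
        by (auto simp: second_singular_def Z_def)
      then obtain x where x: "x \<in> N" "Z +>\<^bsub>M\<^esub> m = Z +>\<^bsub>M\<^esub> x" using im by blast
      then have "m \<in> Z +>\<^bsub>M\<^esub> x" using Z.a_rcos_self[OF m(1)] by simp
      then obtain z where "z \<in> Z" "m = z \<oplus>\<^bsub>M\<^esub> x" by (auto simp: a_r_coset_def')
      then show "m \<in> N" using N(2) submoduleE(5)[OF N(1)] x(1) by (auto simp: Z_def)
    qed
  qed
qed

end

theory Submission
  imports Defs
begin

text \<open>
  Everything rests on reading the module-theoretic notions over \<open>\<Z>\<close> as statements about
  torsion. The essential ideals of \<open>\<Z>\<close> are the nonzero ones, so \<open>Z(M)\<close> is the torsion part of
  \<open>M\<close>, and \<open>Z\<^sub>2(M) = Z(M)\<close> since an extension of torsion by torsion is torsion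
  (\<open>int_singular_iff\<close>, \<open>int_second_singular\<close>).

  The positive assertions are then cheap. In \<open>\<rat>\<close>, and in \<open>\<Z>/p\<^sup>n\<close> with its unique minimal
  subgroup generated by \<open>p\<^bsup>n-1\<^esup>\<close>, any two nonzero submodules meet, and such uniform modules are
  CS (\<open>uniform_imp_CS\<close>); for \<open>M = \<rat> \<oplus> \<Z>/p\<^sup>n\<close> the submodule \<open>Z\<^sub>2(M) = 0 \<oplus> \<Z>/p\<^sup>n\<close> is uniform
  for the same reason. Relative injectivity holds because the only homomorphism from a torsion
  module to a torsion-free one is zero (\<open>torsion_imp_rel_injective\<close>).

  That \<open>M\<close> is not CS comes from a divisibility constraint (\<open>CS_torsion_divisible\<close>): in a CS
  \<open>\<Z>\<close>-module with an element \<open>d\<close> of infinite order, every \<open>t\<close> with \<open>q t = 0\<close>, \<open>q \<noteq> 0\<close>, must lie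
  in \<open>q M\<close>. For the infinite cyclic submodule generated by \<open>q d + t\<close> is essential in a summand
  \<open>K\<close>, which is torsion-free, so that the complement contains \<open>t\<close>; projecting \<open>q d + t\<close> to \<open>K\<close>
  shows that it is \<open>q\<close> times an element. In \<open>M\<close> this fails for \<open>q = p\<^sup>n\<close> and \<open>t = (0, 1)\<close>, as
  \<open>q M = \<rat> \<oplus> 0\<close>.
\<close>

section \<open>Submodules and uniform modules\<close>

text \<open>Negation is multiplication by \<open>\<ominus> \<one>\<close>, so closure under it comes for free. This form is
  convenient for \<open>M\<lparr>carrier := K\<rparr>\<close>, where zero, addition and scalar multiplication reduce to
  those of \<open>M\<close> by record simplification but negation does not.\<close>

lemma submodule_smultI:
  assumes "module R M" "H \<subseteq> carrier M" "\<zero>\<^bsub>M\<^esub> \<in> H"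
    and "\<And>x y. x \<in> H \<Longrightarrow> y \<in> H \<Longrightarrow> x \<oplus>\<^bsub>M\<^esub> y \<in> H"
    and "\<And>r x. r \<in> carrier R \<Longrightarrow> x \<in> H \<Longrightarrow> r \<odot>\<^bsub>M\<^esub> x \<in> H"
  shows "submodule H R M"
proof -
  interpret module R M by fact
  show ?thesis
  proof (rule submoduleI)
    fix x assume x: "x \<in> H"
    then have "\<ominus>\<^bsub>M\<^esub> x = (\<ominus>\<^bsub>R\<^esub> \<one>\<^bsub>R\<^esub>) \<odot>\<^bsub>M\<^esub> x" using assms(2) by (simp add: smult_l_minus subset_iff)
    then show "\<ominus>\<^bsub>M\<^esub> x \<in> H" using assms(5)[of "\<ominus>\<^bsub>R\<^esub> \<one>\<^bsub>R\<^esub>" x] x by simp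
  qed (use assms in auto)
qed

lemma (in module) submodule_zero_closed:
  assumes "submodule H R M"
  shows "\<zero>\<^bsub>M\<^esub> \<in> H"
  using submoduleE(2,4)[OF assms] submoduleE(1)[OF assms] smult_l_null R.zero_closed
  by (metis subset_eq ex_in_conv)

lemma (in module) zero_submodule: "submodule {\<zero>\<^bsub>M\<^esub>} R M"
  by (rule submodule_smultI[OF module_axioms]) simp_all

lemma (in module) cyclic_submodule:
  assumes "x \<in> carrier M"
  shows "submodule ((\<lambda>r. r \<odot>\<^bsub>M\<^esub> x) ` carrier R) R M"
proof (rule submodule_smultI[OF module_axioms])
  show "\<zero>\<^bsub>M\<^esub> \<in> (\<lambda>r. r \<odot>\<^bsub>M\<^esub> x) ` carrier R"
    using assms by (intro image_eqI[of _ _ "\<zero>\<^bsub>R\<^esub>"]) simp_all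
next
  fix y z assume "y \<in> (\<lambda>r. r \<odot>\<^bsub>M\<^esub> x) ` carrier R" "z \<in> (\<lambda>r. r \<odot>\<^bsub>M\<^esub> x) ` carrier R"
  then obtain r s where "r \<in> carrier R" "s \<in> carrier R" "y = r \<odot>\<^bsub>M\<^esub> x" "z = s \<odot>\<^bsub>M\<^esub> x" by blast
  then show "y \<oplus>\<^bsub>M\<^esub> z \<in> (\<lambda>r. r \<odot>\<^bsub>M\<^esub> x) ` carrier R"
    using assms by (intro image_eqI[of _ _ "r \<oplus>\<^bsub>R\<^esub> s"]) (simp_all add: smult_l_distr)
next
  fix r y assume r: "r \<in> carrier R" and "y \<in> (\<lambda>r. r \<odot>\<^bsub>M\<^esub> x) ` carrier R"
  then obtain s where "s \<in> carrier R" "y = s \<odot>\<^bsub>M\<^esub> x" by blast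
  then show "r \<odot>\<^bsub>M\<^esub> y \<in> (\<lambda>r. r \<odot>\<^bsub>M\<^esub> x) ` carrier R"
    using assms r by (intro image_eqI[of _ _ "r \<otimes>\<^bsub>R\<^esub> s"]) (simp_all add: smult_assoc1)
qed (use assms in auto)

lemma (in module) essential_carrier: "essential R M (carrier M)"
  unfolding essential_def using carrier_is_submodule submoduleE(1) by blast

lemma (in module) trivial_summands:
  "internal_sum R M {\<zero>\<^bsub>M\<^esub>} (carrier M)" "internal_sum R M (carrier M) {\<zero>\<^bsub>M\<^esub>}"
  using zero_submodule carrier_is_submodule by (auto simp: internal_sum_def set_add_def')

text \<open>A nonzero submodule of a uniform module is essential in the whole module, and the zero
  submodule is itself a summand.\<close>

lemma uniform_imp_CS:
  assumes "module R M"
    and uniform: "\<And>x y. x \<in> carrier M \<Longrightarrow> y \<in> carrier M \<Longrightarrow> x \<noteq> \<zero>\<^bsub>M\<^esub> \<Longrightarrow> y \<noteq> \<zero>\<^bsub>M\<^esub> \<Longrightarrow>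
      \<exists>r\<in>carrier R. \<exists>s\<in>carrier R. r \<odot>\<^bsub>M\<^esub> x = s \<odot>\<^bsub>M\<^esub> y \<and> r \<odot>\<^bsub>M\<^esub> x \<noteq> \<zero>\<^bsub>M\<^esub>"
  shows "CS_module R M"
proof -
  interpret module R M by fact
  have "\<exists>K. direct_summand R M K \<and> essential R (M\<lparr>carrier := K\<rparr>) N" if N: "submodule N R M" for N
  proof (cases "N = {\<zero>\<^bsub>M\<^esub>}")
    case True
    interpret N: module R "M\<lparr>carrier := N\<rparr>" by (rule submodule.submodule_is_module[OF N module_axioms])
    have "essential R (M\<lparr>carrier := N\<rparr>) N" using N.essential_carrier by simp
    then show ?thesis using trivial_summands(1) True by (auto simp: direct_summand_def)
  next
    case False
    then obtain x where x: "x \<in> N" "x \<noteq> \<zero>\<^bsub>M\<^esub>" using submodule_zero_closed[OF N] by blast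
    have "T = {\<zero>\<^bsub>M\<^esub>}" if T: "submodule T R M" and NT: "N \<inter> T = {\<zero>\<^bsub>M\<^esub>}" for T
    proof (rule ccontr)
      assume "T \<noteq> {\<zero>\<^bsub>M\<^esub>}"
      then obtain y where y: "y \<in> T" "y \<noteq> \<zero>\<^bsub>M\<^esub>" using submodule_zero_closed[OF T] by blast
      obtain r s where rs: "r \<in> carrier R" "s \<in> carrier R" "r \<odot>\<^bsub>M\<^esub> x = s \<odot>\<^bsub>M\<^esub> y" "r \<odot>\<^bsub>M\<^esub> x \<noteq> \<zero>\<^bsub>M\<^esub>"
        using uniform[of x y] x y submoduleE(1)[OF N] submoduleE(1)[OF T] by blast
      then have "r \<odot>\<^bsub>M\<^esub> x \<in> N \<inter> T" using submoduleE(4)[OF N] submoduleE(4)[OF T] x y by force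
      then show False using NT rs by blast
    qed
    then have "essential R M N" using N by (auto simp: essential_def)
    moreover have "direct_summand R M (carrier M)"
      unfolding direct_summand_def using trivial_summands(2) by blast
    ultimately show ?thesis by (intro exI[of _ "carrier M"]) simp
  qed
  then show ?thesis using module_axioms by (auto simp: CS_module_def)
qed

section \<open>Torsion over the integers\<close>

lemma int_smult_smult:
  assumes "module \<Z> M" "x \<in> carrier M"
  shows "k \<odot>\<^bsub>M\<^esub> (l \<odot>\<^bsub>M\<^esub> x) = (k * l) \<odot>\<^bsub>M\<^esub> x"
  using module.smult_assoc1[OF assms(1), of k l x] assms(2) by simp

lemma int_smult_zero:
  assumes "module \<Z> M" "x \<in> carrier M"
  shows "0 \<odot>\<^bsub>M\<^esub> x = \<zero>\<^bsub>M\<^esub>"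
  using module.smult_l_null[OF assms] by simp

lemma int_regular_module: "module \<Z> (regular_module \<Z>)"
  by (rule regular_module_is_module[OF int_is_cring])

text \<open>The essential ideals of \<open>\<Z>\<close> are the nonzero ones, and nonzero principal ideals suffice to
  witness membership in the singular submodule.\<close>

lemma int_singular_iff:
  assumes "module \<Z> M"
  shows "m \<in> singular \<Z> M \<longleftrightarrow> m \<in> carrier M \<and> (\<exists>k. k \<noteq> 0 \<and> k \<odot>\<^bsub>M\<^esub> m = \<zero>\<^bsub>M\<^esub>)"
proof -
  interpret module \<Z> M by fact
  interpret Z: module \<Z> "regular_module \<Z>" by (rule int_regular_module)
  have "\<exists>k\<in>I. k \<noteq> 0" if I: "essential \<Z> (regular_module \<Z>) I" for I
  proof (rule ccontr)
    assume "\<not> (\<exists>k\<in>I. k \<noteq> 0)"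
    then have "I \<inter> UNIV = {0}"
      using Z.submodule_zero_closed[of I] I by (auto simp: essential_def regular_module_def)
    then have "(UNIV :: int set) = {0}"
      using I Z.carrier_is_submodule by (auto simp: essential_def regular_module_def)
    then show False by (metis UNIV_I singletonD zero_neq_one)
  qed
  moreover have "\<exists>I. essential \<Z> (regular_module \<Z>) I \<and> (\<forall>r\<in>I. r \<odot>\<^bsub>M\<^esub> m = \<zero>\<^bsub>M\<^esub>)"
    if k: "k \<noteq> 0" "k \<odot>\<^bsub>M\<^esub> m = \<zero>\<^bsub>M\<^esub>" and m: "m \<in> carrier M" for k
  proof -
    define I where "I = range (\<lambda>r. k * r)"
    have I: "submodule I \<Z> (regular_module \<Z>)"
      using Z.cyclic_submodule[of k] by (simp add: I_def regular_module_def)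
    have "t = 0" if T: "submodule T \<Z> (regular_module \<Z>)" "I \<inter> T = {0}" "t \<in> T" for T t
    proof -
      have "k * t \<in> T" using Z.submoduleE(4)[OF T(1) _ T(3), of k]
        by (simp add: regular_module_def mult.commute)
      then have "k * t \<in> I \<inter> T" by (auto simp: I_def)
      then show ?thesis using T(2) k(1) by simp
    qed
    then have "essential \<Z> (regular_module \<Z>) I"
      using I Z.submodule_zero_closed by (fastforce simp: essential_def regular_module_def)
    moreover have "(k * r) \<odot>\<^bsub>M\<^esub> m = \<zero>\<^bsub>M\<^esub>" for r
      using int_smult_smult[OF assms m, of r k] k(2) smult_r_null[of r] by (simp add: mult.commute)
    ultimately show ?thesis by (auto simp: I_def)
  qed
  ultimately show ?thesis unfolding singular_def by blast
qed

text \<open>Modulo its torsion part a \<open>\<Z>\<close>-module is torsion-free, so that the second step adds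
  nothing.\<close>

lemma int_second_singular:
  assumes "module \<Z> M"
  shows "second_singular \<Z> M = singular \<Z> M"
proof
  interpret module \<Z> M by fact
  let ?Z = "singular \<Z> M"
  show "?Z \<subseteq> second_singular \<Z> M" by (rule second_singular(2))
  interpret Z: abelian_subgroup ?Z M by (rule submodule_abelian_subgroup[OF singular_submodule])
  have Q: "module \<Z> (quotient_module M ?Z)" by (rule quotient_module_is_module[OF singular_submodule])
  show "second_singular \<Z> M \<subseteq> ?Z"
  proof
    fix m assume "m \<in> second_singular \<Z> M"
    then obtain k where m: "m \<in> carrier M" and k: "k \<noteq> 0"
      and "k \<odot>\<^bsub>quotient_module M ?Z\<^esub> (?Z +>\<^bsub>M\<^esub> m) = \<zero>\<^bsub>quotient_module M ?Z\<^esub>"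
      by (auto simp: second_singular_def int_singular_iff[OF Q])
    then have "?Z +>\<^bsub>M\<^esub> (k \<odot>\<^bsub>M\<^esub> m) = ?Z"
      using quotient_smult[OF singular_submodule, of k m] by (simp add: quotient_module_def)
    then have "k \<odot>\<^bsub>M\<^esub> m \<in> ?Z" using Z.a_rcos_self[of "k \<odot>\<^bsub>M\<^esub> m"] m by simp
    then obtain l where "l \<noteq> 0" "(l * k) \<odot>\<^bsub>M\<^esub> m = \<zero>\<^bsub>M\<^esub>"
      using int_singular_iff[OF assms] int_smult_smult[OF assms m] by auto
    then show "m \<in> ?Z" using k m int_singular_iff[OF assms] by (metis mult_eq_0_iff)
  qed
qed

text \<open>All homomorphisms involved are zero, hence extended by the zero map.\<close>

lemma torsion_imp_rel_injective:
  assumes "module \<Z> N" "module \<Z> A"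
    and torsion: "\<And>a. a \<in> carrier A \<Longrightarrow> \<exists>k. k \<noteq> 0 \<and> k \<odot>\<^bsub>A\<^esub> a = \<zero>\<^bsub>A\<^esub>"
    and torsion_free: "\<And>k x. x \<in> carrier N \<Longrightarrow> k \<odot>\<^bsub>N\<^esub> x = \<zero>\<^bsub>N\<^esub> \<Longrightarrow> k \<noteq> 0 \<Longrightarrow> x = \<zero>\<^bsub>N\<^esub>"
  shows "rel_injective \<Z> N A"
  unfolding rel_injective_def
proof (intro allI impI ballI)
  interpret N: module \<Z> N by fact
  interpret A: module \<Z> A by fact
  fix B f assume B: "submodule B \<Z> A" and f: "f \<in> mod_hom \<Z> (A\<lparr>carrier := B\<rparr>) N"
  have fN: "f x \<in> carrier N" and fs: "f (k \<odot>\<^bsub>A\<^esub> x) = k \<odot>\<^bsub>N\<^esub> f x" if "x \<in> B" for x k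
    using f that by (auto simp: mod_hom_def hom_def)
  have z: "\<zero>\<^bsub>A\<^esub> \<in> B" by (rule A.submodule_zero_closed[OF B])
  have f0: "f \<zero>\<^bsub>A\<^esub> = \<zero>\<^bsub>N\<^esub>"
    using fs[OF z, of 0] fN[OF z] int_smult_zero[OF assms(1)] int_smult_zero[OF assms(2)] by simp
  have "f x = \<zero>\<^bsub>N\<^esub>" if x: "x \<in> B" for x
  proof -
    obtain k where "k \<noteq> 0" "k \<odot>\<^bsub>A\<^esub> x = \<zero>\<^bsub>A\<^esub>" using torsion A.submoduleE(1)[OF B] x by blast
    then show ?thesis using torsion_free[OF fN[OF x], of k] fs[OF x, of k] f0 by simp
  qed
  moreover have "(\<lambda>x. \<zero>\<^bsub>N\<^esub>) \<in> mod_hom \<Z> A N" by (auto simp: mod_hom_def hom_def)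
  ultimately show "\<exists>g\<in>mod_hom \<Z> A N. \<forall>x\<in>B. g x = f x" by force
qed

text \<open>The summand \<open>K\<close> in which the span of \<open>y = q d + t\<close> is essential has no torsion, since a torsion
  element would span a submodule meeting that of \<open>y\<close> trivially. Writing \<open>M = K \<oplus> L\<close>, the
  \<open>K\<close>-component of \<open>t\<close> is torsion, so \<open>t \<in> L\<close>; hence the \<open>K\<close>-component of \<open>y\<close>, which is \<open>y\<close> itself,
  is \<open>q\<close> times that of \<open>d\<close>.\<close>

lemma CS_torsion_divisible:
  assumes CS: "CS_module \<Z> M"
    and d: "d \<in> carrier M" "\<And>k. k \<odot>\<^bsub>M\<^esub> d = \<zero>\<^bsub>M\<^esub> \<Longrightarrow> k = 0"
    and t: "t \<in> carrier M" "q \<noteq> 0" "q \<odot>\<^bsub>M\<^esub> t = \<zero>\<^bsub>M\<^esub>"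
  shows "\<exists>c\<in>carrier M. t = q \<odot>\<^bsub>M\<^esub> c"
proof -
  have M: "module \<Z> M" using CS by (simp add: CS_module_def)
  interpret module \<Z> M by fact
  note sm = int_smult_smult[OF M] and s0 = int_smult_zero[OF M]
  have sc: "k \<odot>\<^bsub>M\<^esub> x \<in> carrier M" if "x \<in> carrier M" for k x using smult_closed[of k x] that by simp
  have sz: "k \<odot>\<^bsub>M\<^esub> \<zero>\<^bsub>M\<^esub> = \<zero>\<^bsub>M\<^esub>" for k using smult_r_null[of k] by simp
  have sd: "k \<odot>\<^bsub>M\<^esub> (x \<oplus>\<^bsub>M\<^esub> z) = k \<odot>\<^bsub>M\<^esub> x \<oplus>\<^bsub>M\<^esub> k \<odot>\<^bsub>M\<^esub> z" if "x \<in> carrier M" "z \<in> carrier M" for k x z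
    using smult_r_distr[of k x z] that by simp
  define y where "y = q \<odot>\<^bsub>M\<^esub> d \<oplus>\<^bsub>M\<^esub> t"
  have yM: "y \<in> carrier M" using d t sc by (simp add: y_def)
  have y_free: "k = 0" if "k \<odot>\<^bsub>M\<^esub> y = \<zero>\<^bsub>M\<^esub>" for k
  proof -
    have "q \<odot>\<^bsub>M\<^esub> (k \<odot>\<^bsub>M\<^esub> y) = k \<odot>\<^bsub>M\<^esub> (q \<odot>\<^bsub>M\<^esub> y)" by (simp add: sm yM mult.commute)
    also have "\<dots> = (k * (q * q)) \<odot>\<^bsub>M\<^esub> d" using d(1) t sc by (simp add: y_def sd sm)
    finally show ?thesis using that d(2) t(2) sz by force
  qed
  define N where "N = range (\<lambda>k. k \<odot>\<^bsub>M\<^esub> y)"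
  have N: "submodule N \<Z> M" using cyclic_submodule[OF yM] by (simp add: N_def)
  obtain K L where KL: "internal_sum \<Z> M K L" and ess: "essential \<Z> (M\<lparr>carrier := K\<rparr>) N"
    using CS N by (auto simp: CS_module_def direct_summand_def)
  have K: "submodule K \<Z> M" and L: "submodule L \<Z> M" and KL0: "K \<inter> L = {\<zero>\<^bsub>M\<^esub>}"
    using KL by (auto simp: internal_sum_def)
  have KM: "K \<subseteq> carrier M" and LM: "L \<subseteq> carrier M" using submoduleE(1) K L by auto
  have Ks: "k \<odot>\<^bsub>M\<^esub> x \<in> K" if "x \<in> K" for k x using submoduleE(4)[OF K, of k x] that by simp
  have Ls: "k \<odot>\<^bsub>M\<^esub> x \<in> L" if "x \<in> L" for k x using submoduleE(4)[OF L, of k x] that by simp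
  have split: "\<exists>a\<in>K. \<exists>b\<in>L. x = a \<oplus>\<^bsub>M\<^esub> b" if "x \<in> carrier M" for x
    using KL that unfolding internal_sum_def set_add_def' by blast
  have unique: "a = a'"
    if "a \<in> K" "a' \<in> K" "b \<in> L" "b' \<in> L" "a \<oplus>\<^bsub>M\<^esub> b = a' \<oplus>\<^bsub>M\<^esub> b'" for a a' b b'
  proof -
    have c: "a \<in> carrier M" "a' \<in> carrier M" "b \<in> carrier M" "b' \<in> carrier M"
      using that KM LM by auto
    have "a \<oplus>\<^bsub>M\<^esub> (\<ominus>\<^bsub>M\<^esub> a') = (a \<oplus>\<^bsub>M\<^esub> b) \<oplus>\<^bsub>M\<^esub> (\<ominus>\<^bsub>M\<^esub> a' \<oplus>\<^bsub>M\<^esub> \<ominus>\<^bsub>M\<^esub> b)"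
      using c by (simp add: M.a_ac M.r_neg M.r_neg1 M.r_neg2)
    also have "\<dots> = b' \<oplus>\<^bsub>M\<^esub> (a' \<oplus>\<^bsub>M\<^esub> (\<ominus>\<^bsub>M\<^esub> a' \<oplus>\<^bsub>M\<^esub> \<ominus>\<^bsub>M\<^esub> b))"
      unfolding that(5) using c by (simp add: M.a_ac)
    also have "\<dots> = b' \<oplus>\<^bsub>M\<^esub> (\<ominus>\<^bsub>M\<^esub> b)" using c by (simp add: M.r_neg2)
    finally have eq: "a \<oplus>\<^bsub>M\<^esub> (\<ominus>\<^bsub>M\<^esub> a') = b' \<oplus>\<^bsub>M\<^esub> (\<ominus>\<^bsub>M\<^esub> b)" .
    have "a \<oplus>\<^bsub>M\<^esub> (\<ominus>\<^bsub>M\<^esub> a') \<in> K" "b' \<oplus>\<^bsub>M\<^esub> (\<ominus>\<^bsub>M\<^esub> b) \<in> L"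
      using that submoduleE(3,5)[OF K] submoduleE(3,5)[OF L] by blast+
    then have "a \<oplus>\<^bsub>M\<^esub> (\<ominus>\<^bsub>M\<^esub> a') = \<zero>\<^bsub>M\<^esub>" using KL0 eq by auto
    then show ?thesis using c by (metis M.add.inv_closed M.minus_equality M.minus_minus)
  qed
  have K_free: "x = \<zero>\<^bsub>M\<^esub>" if x: "x \<in> K" "q \<odot>\<^bsub>M\<^esub> x = \<zero>\<^bsub>M\<^esub>" for x
  proof -
    interpret K: module \<Z> "M\<lparr>carrier := K\<rparr>" by (rule submodule.submodule_is_module[OF K M])
    define T where "T = range (\<lambda>k. k \<odot>\<^bsub>M\<^esub> x)"
    have xM: "x \<in> carrier M" using x KM by blast
    have T: "submodule T \<Z> (M\<lparr>carrier := K\<rparr>)" using K.cyclic_submodule[of x] x by (simp add: T_def)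
    have "a \<odot>\<^bsub>M\<^esub> y = \<zero>\<^bsub>M\<^esub>" if e: "a \<odot>\<^bsub>M\<^esub> y = b \<odot>\<^bsub>M\<^esub> x" for a b
    proof -
      have "(q * a) \<odot>\<^bsub>M\<^esub> y = q \<odot>\<^bsub>M\<^esub> (b \<odot>\<^bsub>M\<^esub> x)" by (simp add: sm[OF yM, symmetric] e)
      also have "\<dots> = b \<odot>\<^bsub>M\<^esub> (q \<odot>\<^bsub>M\<^esub> x)" by (simp add: sm xM mult.commute)
      also have "\<dots> = \<zero>\<^bsub>M\<^esub>" by (simp add: x sz)
      finally have "a = 0" using y_free t(2) by force
      then show ?thesis using s0[OF yM] by simp
    qed
    then have "N \<inter> T \<subseteq> {\<zero>\<^bsub>M\<^esub>}" by (auto simp: N_def T_def)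
    moreover have "\<zero>\<^bsub>M\<^esub> \<in> N \<inter> T" using submodule_zero_closed[OF N] K.submodule_zero_closed[OF T] by simp
    ultimately have "N \<inter> T = {\<zero>\<^bsub>M\<^esub>}" by blast
    then have "T = {\<zero>\<^bsub>M\<^esub>}" using ess T by (auto simp: essential_def)
    moreover have "x \<in> T" using smult_one[OF xM] by (auto simp: T_def intro!: image_eqI[of _ _ 1])
    ultimately show ?thesis by simp
  qed
  have tL: "t \<in> L"
  proof -
    obtain a b where ab: "a \<in> K" "b \<in> L" "t = a \<oplus>\<^bsub>M\<^esub> b" using split[OF t(1)] by blast
    have c: "a \<in> carrier M" "b \<in> carrier M" using ab KM LM by auto
    have "q \<odot>\<^bsub>M\<^esub> a \<oplus>\<^bsub>M\<^esub> q \<odot>\<^bsub>M\<^esub> b = \<zero>\<^bsub>M\<^esub> \<oplus>\<^bsub>M\<^esub> \<zero>\<^bsub>M\<^esub>" using t(3) c by (simp add: ab sd)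
    then have "q \<odot>\<^bsub>M\<^esub> a = \<zero>\<^bsub>M\<^esub>"
      by (rule unique[rotated 4]) (use ab Ks Ls submodule_zero_closed K L in auto)
    then have "a = \<zero>\<^bsub>M\<^esub>" using K_free ab by blast
    then show ?thesis using ab c by simp
  qed
  have yK: "y \<in> K"
  proof -
    have "N \<subseteq> K" using ess submodule.axioms(1) subgroup.subset
      by (fastforce simp: essential_def)
    moreover have "y \<in> N" using smult_one[OF yM] by (auto simp: N_def intro!: image_eqI[of _ _ 1])
    ultimately show ?thesis by blast
  qed
  obtain a b where ab: "a \<in> K" "b \<in> L" "d = a \<oplus>\<^bsub>M\<^esub> b" using split[OF d(1)] by blast
  have c: "a \<in> carrier M" "b \<in> carrier M" using ab KM LM by auto
  have "y \<oplus>\<^bsub>M\<^esub> \<zero>\<^bsub>M\<^esub> = q \<odot>\<^bsub>M\<^esub> a \<oplus>\<^bsub>M\<^esub> (q \<odot>\<^bsub>M\<^esub> b \<oplus>\<^bsub>M\<^esub> t)"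
    using yM c t sc by (simp add: y_def ab sd M.a_assoc)
  then have y: "y = q \<odot>\<^bsub>M\<^esub> a"
    by (rule unique[rotated 4])
      (use yK ab Ks Ls tL submodule_zero_closed[OF L] submoduleE(5)[OF L] in auto)
  have "t = q \<odot>\<^bsub>M\<^esub> (a \<oplus>\<^bsub>M\<^esub> \<ominus>\<^bsub>M\<^esub> d)"
  proof -
    have "t = y \<oplus>\<^bsub>M\<^esub> \<ominus>\<^bsub>M\<^esub> (q \<odot>\<^bsub>M\<^esub> d)"
      using d t sc by (simp add: y_def M.a_ac M.r_neg)
    also have "\<dots> = q \<odot>\<^bsub>M\<^esub> (a \<oplus>\<^bsub>M\<^esub> \<ominus>\<^bsub>M\<^esub> d)"
      using smult_r_minus[of q d] d c by (simp add: y sd)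
    finally show ?thesis .
  qed
  then show ?thesis using c d by blast
qed

section \<open>The modules of the counterexample\<close>

lemma rat_module_is_module: "module \<Z> rat_module"
proof (intro moduleI int_is_cring abelian_groupI)
  fix x assume "x \<in> carrier rat_module"
  show "\<exists>y\<in>carrier rat_module. y \<oplus>\<^bsub>rat_module\<^esub> x = \<zero>\<^bsub>rat_module\<^esub>"
    by (intro bexI[of _ "- x"]) (simp_all add: rat_module_def)
qed (simp_all add: rat_module_def algebra_simps)

lemma rat_uniform:
  fixes x y :: rat
  assumes "x \<noteq> 0" "y \<noteq> 0"
  shows "\<exists>r s :: int. of_int r * x = of_int s * y \<and> of_int r * x \<noteq> 0"
proof -
  obtain a b where x: "x = of_int a / of_int b" "b \<noteq> 0"
    by (cases x) (auto simp: Fract_of_int_quotient)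
  obtain c d where y: "y = of_int c / of_int d" "d \<noteq> 0"
    by (cases y) (auto simp: Fract_of_int_quotient)
  have "of_int (c * b) * x = of_int (a * d) * y" using x y by simp
  moreover have "of_int (c * b) * x \<noteq> 0" using x y assms by auto
  ultimately show ?thesis by blast
qed

lemma module_sum_is_module:
  assumes "module R M" "module R N"
  shows "module R (module_sum M N)"
proof -
  interpret M: module R M by fact
  interpret N: module R N by fact
  have "abelian_group (module_sum M N)"
  proof (rule abelian_groupI)
    fix x assume "x \<in> carrier (module_sum M N)"
    then show "\<exists>y\<in>carrier (module_sum M N). y \<oplus>\<^bsub>module_sum M N\<^esub> x = \<zero>\<^bsub>module_sum M N\<^esub>"
      by (intro bexI[of _ "(\<ominus>\<^bsub>M\<^esub> fst x, \<ominus>\<^bsub>N\<^esub> snd x)"])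
        (auto simp: module_sum_def M.M.l_neg N.M.l_neg)
  qed (auto simp: module_sum_def M.M.a_ac N.M.a_ac)
  then show ?thesis
    by (intro moduleI M.R.is_cring)
      (auto simp: module_sum_def M.smult_l_distr N.smult_l_distr M.smult_r_distr N.smult_r_distr
        M.smult_assoc1 N.smult_assoc1)
qed

definition Zmod_class :: "int \<Rightarrow> int \<Rightarrow> int set"
  where "Zmod_class q x = PIdl\<^bsub>\<Z>\<^esub> q +>\<^bsub>regular_module \<Z>\<^esub> x"

lemma Zmod_submodule: "submodule (PIdl\<^bsub>\<Z>\<^esub> q) \<Z> (regular_module \<Z>)"
proof -
  interpret Z: module \<Z> "regular_module \<Z>" by (rule int_regular_module)
  have "PIdl\<^bsub>\<Z>\<^esub> q = (\<lambda>r. r \<odot>\<^bsub>regular_module \<Z>\<^esub> q) ` carrier \<Z>"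
    by (auto simp: cgenideal_def regular_module_def mult.commute)
  then show ?thesis using Z.cyclic_submodule[of q] by (simp add: regular_module_def)
qed

lemma Zmod_module_is_module: "module \<Z> (Zmod_module q)"
  unfolding Zmod_module_def
  by (rule module.quotient_module_is_module[OF int_regular_module Zmod_submodule])

lemma carrier_Zmod: "carrier (Zmod_module q) = range (Zmod_class q)"
  by (auto simp: Zmod_module_def quotient_module_def A_RCOSETS_def' Zmod_class_def regular_module_def)

lemma smult_Zmod: "k \<odot>\<^bsub>Zmod_module q\<^esub> Zmod_class q x = Zmod_class q (k * x)"
  using module.quotient_smult[OF int_regular_module Zmod_submodule[of q], of k x]
  by (simp add: Zmod_module_def Zmod_class_def regular_module_def mult.commute)

lemma Zmod_class_eq_zero: "Zmod_class q x = \<zero>\<^bsub>Zmod_module q\<^esub> \<longleftrightarrow> q dvd x"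
proof -
  interpret N: abelian_subgroup "PIdl\<^bsub>\<Z>\<^esub> q" "regular_module \<Z>"
    by (rule module.submodule_abelian_subgroup[OF int_regular_module Zmod_submodule])
  have "Zmod_class q x = PIdl\<^bsub>\<Z>\<^esub> q \<longleftrightarrow> x \<in> PIdl\<^bsub>\<Z>\<^esub> q"
    using N.a_rcos_self[of x] N.a_rcos_const[of x] by (auto simp: Zmod_class_def regular_module_def)
  then show ?thesis
    by (auto simp: Zmod_module_def quotient_module_def cgenideal_def dvd_def mult.commute)
qed

text \<open>The class of \<open>p\<^bsup>n-1\<^esup>\<close> generates the unique minimal subgroup of \<open>\<Z>/p\<^sup>n\<close>: by Bezout, any
  \<open>x\<close> that is not divisible by \<open>p\<^sup>n\<close> has a multiple congruent to \<open>gcd x (p\<^sup>n) = p\<^sup>i\<close> with \<open>i < n\<close>.\<close>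

lemma prime_power_multiple:
  fixes x :: int
  assumes "prime p" "\<not> int p ^ n dvd x"
  shows "\<exists>r. int p ^ n dvd r * x - int p ^ (n - 1)"
proof -
  have "prime (int p)" using assms(1) by simp
  then obtain i where i: "i \<le> n" "gcd x (int p ^ n) = int p ^ i"
    using divides_primepow[of "int p" "gcd x (int p ^ n)" n] by auto
  have "i \<noteq> n" using assms(2) i by (metis gcd_dvd1)
  then have i': "n - 1 = i + (n - 1 - i)" using i by simp
  obtain u v where uv: "u * x + v * int p ^ n = int p ^ i" using bezout_int[of x "int p ^ n"] i by auto
  have "int p ^ (n - 1) = int p ^ (n - 1 - i) * (u * x + v * int p ^ n)"
    unfolding uv by (subst i') (simp add: power_add)
  then have "int p ^ (n - 1 - i) * u * x - int p ^ (n - 1) = int p ^ n * (- (int p ^ (n - 1 - i) * v))"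
    by (simp add: algebra_simps)
  then show ?thesis by (metis dvd_triv_left)
qed

lemma Zmod_uniform:
  assumes p: "prime p" and n: "n > 0"
    and "X \<in> carrier (Zmod_module (int p ^ n))" "Y \<in> carrier (Zmod_module (int p ^ n))"
    and "X \<noteq> \<zero>\<^bsub>Zmod_module (int p ^ n)\<^esub>" "Y \<noteq> \<zero>\<^bsub>Zmod_module (int p ^ n)\<^esub>"
  shows "\<exists>r s. r \<odot>\<^bsub>Zmod_module (int p ^ n)\<^esub> X = s \<odot>\<^bsub>Zmod_module (int p ^ n)\<^esub> Y
    \<and> r \<odot>\<^bsub>Zmod_module (int p ^ n)\<^esub> X \<noteq> \<zero>\<^bsub>Zmod_module (int p ^ n)\<^esub>"
proof -
  define q where "q = int p ^ n"
  obtain x y where x: "X = Zmod_class q x" and y: "Y = Zmod_class q y"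
    using assms by (auto simp: carrier_Zmod q_def)
  have "\<not> q dvd x" "\<not> q dvd y" using assms x y by (auto simp: Zmod_class_eq_zero q_def)
  then obtain r s where r: "q dvd r * x - int p ^ (n - 1)" and s: "q dvd s * y - int p ^ (n - 1)"
    using prime_power_multiple[OF p] q_def by metis
  have *: "Zmod_class q a = Zmod_class q (int p ^ (n - 1))" if "q dvd a - int p ^ (n - 1)" for a
  proof -
    from that obtain c where "a - int p ^ (n - 1) = q * c" by (rule dvdE)
    then have a: "a = q * c + int p ^ (n - 1)" by simp
    interpret N: abelian_subgroup "PIdl\<^bsub>\<Z>\<^esub> q" "regular_module \<Z>"
      by (rule module.submodule_abelian_subgroup[OF int_regular_module Zmod_submodule])
    have "a \<in> PIdl\<^bsub>\<Z>\<^esub> q +>\<^bsub>regular_module \<Z>\<^esub> (int p ^ (n - 1))"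
      by (auto simp: a a_r_coset_def' regular_module_def cgenideal_def mult.commute)
    then show ?thesis unfolding Zmod_class_def
      by (intro N.a_repr_independence'[symmetric]) (simp_all add: regular_module_def)
  qed
  have "\<not> q dvd int p ^ (n - 1)"
  proof
    assume "q dvd int p ^ (n - 1)"
    then have "p ^ n dvd p ^ (n - 1)" by (simp add: q_def flip: of_nat_power)
    then have "n \<le> n - 1" using prime_gt_1_nat[OF p] by (rule power_dvd_imp_le)
    then show False using n by simp
  qed
  then show ?thesis
    unfolding x y q_def[symmetric]
    by (intro exI[of _ r] exI[of _ s]) (simp add: smult_Zmod *[OF r] *[OF s] Zmod_class_eq_zero)
qed

lemma Zmod_annihilated:
  assumes "X \<in> carrier (Zmod_module q)"
  shows "q \<odot>\<^bsub>Zmod_module q\<^esub> X = \<zero>\<^bsub>Zmod_module q\<^esub>"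
proof -
  obtain x where "X = Zmod_class q x" using assms by (auto simp: carrier_Zmod)
  then show ?thesis by (simp add: smult_Zmod Zmod_class_eq_zero)
qed

theorem mainTheorem3:
  fixes p n :: nat
  assumes "prime p" and "n \<ge> 2"
  shows "CS_module \<Z> rat_module
    \<and> CS_module \<Z> (Zmod_module (int p ^ n))
    \<and> rel_injective \<Z> rat_module (Zmod_module (int p ^ n))
    \<and> (let M = module_sum rat_module (Zmod_module (int p ^ n)) in
         module \<Z> M \<and> CS_module \<Z> (M\<lparr>carrier := second_singular \<Z> M\<rparr>) \<and> \<not> CS_module \<Z> M)
    \<and> \<not> (\<forall>(M :: (int, rat \<times> int set) module) M1 M2.
           module \<Z> M \<longrightarrow>
           internal_sum \<Z> M M1 M2 \<longrightarrow>
           CS_module \<Z> (M\<lparr>carrier := M1\<rparr>) \<longrightarrow>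
           CS_module \<Z> (M\<lparr>carrier := M2\<rparr>) \<longrightarrow>
           rel_injective \<Z> (M\<lparr>carrier := M1\<rparr>) (M\<lparr>carrier := M2\<rparr>) \<longrightarrow>
           (CS_module \<Z> M \<longleftrightarrow> CS_module \<Z> (M\<lparr>carrier := second_singular \<Z> M\<rparr>)))"
proof -
  define q where "q = int p ^ n"
  define W where "W = Zmod_module q"
  define M where "M = module_sum rat_module W"
  define M1 where "M1 = (UNIV :: rat set) \<times> {\<zero>\<^bsub>W\<^esub>}"
  define M2 where "M2 = {0 :: rat} \<times> carrier W"
  have q1: "q > 1" using prime_gt_1_nat[OF assms(1)] assms(2) by (simp add: q_def)
  interpret W: module \<Z> W unfolding W_def by (rule Zmod_module_is_module)
  have modM: "module \<Z> M"
    unfolding M_def by (rule module_sum_is_module[OF rat_module_is_module W.module_axioms])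
  interpret M: module \<Z> M by (rule modM)
  have Wz: "r \<odot>\<^bsub>W\<^esub> \<zero>\<^bsub>W\<^esub> = \<zero>\<^bsub>W\<^esub>" for r using W.smult_r_null[of r] by simp
  have Ws: "r \<odot>\<^bsub>W\<^esub> x \<in> carrier W" if "x \<in> carrier W" for r x using W.smult_closed[of r x] that by simp
  have Wq: "q \<odot>\<^bsub>W\<^esub> x = \<zero>\<^bsub>W\<^esub>" if "x \<in> carrier W" for x using Zmod_annihilated that by (simp add: W_def)
  have W_uniform: "\<exists>r s. r \<odot>\<^bsub>W\<^esub> x = s \<odot>\<^bsub>W\<^esub> y \<and> r \<odot>\<^bsub>W\<^esub> x \<noteq> \<zero>\<^bsub>W\<^esub>"
    if "x \<in> carrier W" "y \<in> carrier W" "x \<noteq> \<zero>\<^bsub>W\<^esub>" "y \<noteq> \<zero>\<^bsub>W\<^esub>" for x y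
    using Zmod_uniform[OF assms(1), of n x y] assms(2) that by (simp add: W_def q_def)

  have Q_CS: "CS_module \<Z> rat_module"
    by (rule uniform_imp_CS[OF rat_module_is_module])
      (use rat_uniform in \<open>simp add: rat_module_def\<close>)
  have W_CS: "CS_module \<Z> W"
    by (rule uniform_imp_CS[OF W.module_axioms]) (use W_uniform in simp)
  have inj: "rel_injective \<Z> rat_module W"
  proof (rule torsion_imp_rel_injective[OF rat_module_is_module W.module_axioms])
    show "\<exists>k. k \<noteq> 0 \<and> k \<odot>\<^bsub>W\<^esub> a = \<zero>\<^bsub>W\<^esub>" if "a \<in> carrier W" for a using q1 Wq[OF that] by (intro exI[of _ q]) simp
  qed (auto simp: rat_module_def)

  have S: "second_singular \<Z> M = M2"
  proof -
    have "(\<exists>k. k \<noteq> 0 \<and> k \<odot>\<^bsub>M\<^esub> m = \<zero>\<^bsub>M\<^esub>) \<longleftrightarrow> fst m = 0" if "m \<in> carrier M" for m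
      using that Wq q1 by (auto simp: M_def module_sum_def rat_module_def intro!: exI[of _ q])
    then have "second_singular \<Z> M = {m \<in> carrier M. fst m = 0}"
      using int_second_singular[OF modM] int_singular_iff[OF modM] by blast
    also have "\<dots> = M2" by (auto simp: M2_def M_def module_sum_def rat_module_def)
    finally show ?thesis .
  qed
  have M1: "submodule M1 \<Z> M" and M2: "submodule M2 \<Z> M"
    by (rule submodule_smultI[OF modM]; auto simp: M1_def M2_def M_def module_sum_def rat_module_def Wz Ws)+
  note modM1 = submodule.submodule_is_module[OF M1 modM]
  note modM2 = submodule.submodule_is_module[OF M2 modM]
  have M1_CS: "CS_module \<Z> (M\<lparr>carrier := M1\<rparr>)"
    by (rule uniform_imp_CS[OF modM1])
      (use rat_uniform in \<open>fastforce simp: M1_def M_def module_sum_def rat_module_def Wz\<close>)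
  have M2_CS: "CS_module \<Z> (M\<lparr>carrier := M2\<rparr>)"
  proof (rule uniform_imp_CS[OF modM2])
    let ?M2 = "M\<lparr>carrier := M2\<rparr>"
    fix x y assume "x \<in> carrier ?M2" "y \<in> carrier ?M2" "x \<noteq> \<zero>\<^bsub>?M2\<^esub>" "y \<noteq> \<zero>\<^bsub>?M2\<^esub>"
    then obtain u v where uv: "x = (0, u)" "y = (0, v)" "u \<in> carrier W" "v \<in> carrier W"
        "u \<noteq> \<zero>\<^bsub>W\<^esub>" "v \<noteq> \<zero>\<^bsub>W\<^esub>"
      unfolding M2_def M_def module_sum_def rat_module_def by fastforce
    then obtain r s where "r \<odot>\<^bsub>W\<^esub> u = s \<odot>\<^bsub>W\<^esub> v" "r \<odot>\<^bsub>W\<^esub> u \<noteq> \<zero>\<^bsub>W\<^esub>" using W_uniform by blast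
    then show "\<exists>r\<in>carrier \<Z>. \<exists>s\<in>carrier \<Z>. r \<odot>\<^bsub>?M2\<^esub> x = s \<odot>\<^bsub>?M2\<^esub> y \<and> r \<odot>\<^bsub>?M2\<^esub> x \<noteq> \<zero>\<^bsub>?M2\<^esub>"
      by (intro bexI[of _ r] bexI[of _ s]) (simp_all add: uv M_def module_sum_def rat_module_def)
  qed
  have sum: "internal_sum \<Z> M M1 M2"
    using M1 M2 unfolding internal_sum_def
    by (force simp: M1_def M2_def M_def module_sum_def rat_module_def set_add_def')
  have inj': "rel_injective \<Z> (M\<lparr>carrier := M1\<rparr>) (M\<lparr>carrier := M2\<rparr>)"
  proof (rule torsion_imp_rel_injective[OF modM1 modM2])
    show "\<exists>k. k \<noteq> 0 \<and> k \<odot>\<^bsub>M\<lparr>carrier := M2\<rparr>\<^esub> a = \<zero>\<^bsub>M\<lparr>carrier := M2\<rparr>\<^esub>"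
      if "a \<in> carrier (M\<lparr>carrier := M2\<rparr>)" for a
      using q1 Wq that by (auto simp: M2_def M_def module_sum_def rat_module_def intro!: exI[of _ q])
  qed (auto simp: M1_def M_def module_sum_def rat_module_def)

  have not_CS: "\<not> CS_module \<Z> M"
  proof
    assume CS: "CS_module \<Z> M"
    define u where "u = Zmod_class q 1"
    have u: "u \<in> carrier W" "u \<noteq> \<zero>\<^bsub>W\<^esub>"
      using q1 Zmod_class_eq_zero[of q 1] by (auto simp: u_def W_def carrier_Zmod)
    have "\<exists>c\<in>carrier M. (0, u) = q \<odot>\<^bsub>M\<^esub> c"
    proof (rule CS_torsion_divisible[OF CS, where d = "(1, \<zero>\<^bsub>W\<^esub>)"])
      show "(0, u) \<in> carrier M" "(1, \<zero>\<^bsub>W\<^esub>) \<in> carrier M" "q \<odot>\<^bsub>M\<^esub> (0, u) = \<zero>\<^bsub>M\<^esub>"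
        using u Wq by (auto simp: M_def module_sum_def rat_module_def)
    qed (use q1 in \<open>auto simp: M_def module_sum_def rat_module_def\<close>)
    then show False using u Wq by (auto simp: M_def module_sum_def)
  qed
  show ?thesis
    using Q_CS W_CS inj modM S M1_CS M2_CS sum inj' not_CS
    unfolding Let_def q_def[symmetric] W_def[symmetric] M_def[symmetric] by metis
qed

end
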